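(* Let $I$ be an ideal of a ring $R$. Then the following conditions are equivalent. (i) $I$ is an N-pure ideal. (ii) For every $a_1,\dots,a_n\in I$ there exist $b\in I$ and $t\geq 1$ such that $a_k^{t}=a_k^{t}b$ for all $k=1,\dots,n$. (iii) For every $a\in I$ there exists $t\geq 1$ such that $\mathrm{Ann}(a^{t})+I=R$. (iv) $\sqrt{I}=\{a\in R \mid \exists\, n\geq 1,\ \mathrm{Ann}(a^{n})+I=R\}$. (v) $\sqrt{I}$ is an N-pure ideal. (vi) There exists a unique pure ideal $J$ of $R$ such that $\sqrt{I}=\sqrt{J}$.
   Context: All rings are commutative with identity. $\mathfrak{N}$ denotes the nil-radical of $R$, and $\mathrm{Ann}(a)=\{r\in R: ra=0\}$. An ideal $I$ of $R$ is called pure if for each $a\in I$ there exists $b\in I$ such that $a(1-b)=0$. An ideal $I$ of $R$ is called N-pure if for every $a\in I$ there exists $b\in I$ such that $a(1-b)\in\mathfrak{N}$. *)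

theory Defs
  imports "HOL-Algebra.Algebra"
begin

definition nilradical :: "('a, 'm) ring_scheme \<Rightarrow> 'a set"
  where "nilradical R =
    {a \<in> carrier R. \<exists>n::nat. n \<ge> 1 \<and> a [^]\<^bsub>R\<^esub> n = \<zero>\<^bsub>R\<^esub>}"

definition ideal_radical :: "('a, 'm) ring_scheme \<Rightarrow> 'a set \<Rightarrow> 'a set"
  where "ideal_radical R I =
    {a \<in> carrier R. \<exists>n::nat. n \<ge> 1 \<and> a [^]\<^bsub>R\<^esub> n \<in> I}"

definition annihilator :: "('a, 'm) ring_scheme \<Rightarrow> 'a \<Rightarrow> 'a set"
  where "annihilator R a = {r \<in> carrier R. r \<otimes>\<^bsub>R\<^esub> a = \<zero>\<^bsub>R\<^esub>}"

definition pure_ideal :: "'a set \<Rightarrow> ('a, 'm) ring_scheme \<Rightarrow> bool"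
  where "pure_ideal I R \<longleftrightarrow> ideal I R \<and>
    (\<forall>a\<in>I. \<exists>b\<in>I. a \<otimes>\<^bsub>R\<^esub> (\<one>\<^bsub>R\<^esub> \<ominus>\<^bsub>R\<^esub> b) = \<zero>\<^bsub>R\<^esub>)"

definition N_pure_ideal :: "'a set \<Rightarrow> ('a, 'm) ring_scheme \<Rightarrow> bool"
  where "N_pure_ideal I R \<longleftrightarrow> ideal I R \<and>
    (\<forall>a\<in>I. \<exists>b\<in>I. a \<otimes>\<^bsub>R\<^esub> (\<one>\<^bsub>R\<^esub> \<ominus>\<^bsub>R\<^esub> b) \<in> nilradical R)"

end

theory Submission
  imports Defs
begin

text \<open>
  Membership of \<open>a(1 - b)\<close> in the nilradical says \<open>a\<^sup>t(1 - b)\<^sup>t = 0\<close> for some \<open>t\<close>, and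
  \<open>(1 - b)\<^sup>t = 1 - c\<close> with \<open>c\<close> in any ideal containing \<open>b\<close>. Hence N-purity of \<open>I\<close> means that
  every \<open>a \<in> I\<close> has a power with \<open>a\<^sup>t = a\<^sup>t c\<close> for some \<open>c \<in> I\<close>, which is comaximality
  of \<open>Ann(a\<^sup>t)\<close> and \<open>I\<close>. The pure ideal with the same radical is
  \<open>J = {a. \<exists>b\<in>I. a(1 - b) = 0}\<close>; uniqueness holds because \<open>a(1 - b) = 0\<close> forces \<open>a = a b\<^sup>m\<close>,
  so that pure ideals with equal radicals contain each other.
\<close>

context cring
begin

section \<open>Elements fixed by a multiplier, and the factors \<open>1 - b\<close>\<close>

lemma fixed_by_iff:
  assumes "a \<in> carrier R" "b \<in> carrier R"
  shows "a \<otimes> (\<one> \<ominus> b) = \<zero> \<longleftrightarrow> a = a \<otimes> b"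
proof -
  have "a \<otimes> (\<one> \<ominus> b) = a \<ominus> a \<otimes> b"
    using assms by algebra
  then show ?thesis
    using assms by simp
qed

lemma fixed_by_pow:
  assumes "a \<in> carrier R" "b \<in> carrier R" "a = a \<otimes> b"
  shows "a = a \<otimes> b [^] (n::nat)"
proof (induction n)
  case (Suc n)
  have "a \<otimes> b [^] Suc n = (a \<otimes> b [^] n) \<otimes> b"
    using assms(1,2) by (simp add: m_assoc)
  with Suc assms(3) show ?case
    by simp
qed (use assms in simp)

text \<open>The elements \<open>1 - b\<close> with \<open>b\<close> in \<open>I\<close> form the
  coset \<open>1 + I\<close>, which is closed under products. This is what merges two multipliers
  from \<open>I\<close> into a single one.\<close>

lemma one_minus_mult:
  assumes "ideal I R" "b \<in> I" "c \<in> I"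
  shows "\<exists>d\<in>I. (\<one> \<ominus> b) \<otimes> (\<one> \<ominus> c) = \<one> \<ominus> d"
proof -
  interpret I: ideal I R by fact
  have bc: "b \<in> carrier R" "c \<in> carrier R"
    using assms I.Icarr by auto
  have "b \<oplus> c \<otimes> (\<one> \<ominus> b) \<in> I"
    using assms bc by (simp add: I.I_r_closed)
  moreover have "(\<one> \<ominus> b) \<otimes> (\<one> \<ominus> c) = \<one> \<ominus> (b \<oplus> c \<otimes> (\<one> \<ominus> b))"
    using bc by algebra
  ultimately show ?thesis by blast
qed

lemma one_minus_pow:
  assumes "ideal I R" "b \<in> I"
  shows "\<exists>c\<in>I. (\<one> \<ominus> b) [^] (n::nat) = \<one> \<ominus> c"
proof (induction n)
  case 0
  interpret I: ideal I R by fact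
  show ?case
    by (intro bexI[of _ \<zero>]) (simp_all add: minus_eq)
next
  case (Suc n)
  then show ?case
    using one_minus_mult[OF assms(1) _ assms(2)] by fastforce
qed

text \<open>The cofactor is the geometric sum \<open>1 + b + ... + b^(n-1)\<close>, built up by
  Horner's rule. It later allows a multiplier \<open>b\<close> to be replaced by one of its
  powers.\<close>

lemma one_minus_dvd_one_minus_pow:
  assumes "b \<in> carrier R"
  shows "\<exists>c\<in>carrier R. \<one> \<ominus> b [^] (n::nat) = c \<otimes> (\<one> \<ominus> b)"
proof (induction n)
  case 0
  show ?case
    using assms by (intro bexI[of _ \<zero>]) (simp_all add: minus_eq r_neg)
next
  case (Suc n)
  then obtain c where c: "c \<in> carrier R" "\<one> \<ominus> b [^] n = c \<otimes> (\<one> \<ominus> b)"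
    by blast
  have "\<one> \<ominus> b [^] Suc n = (\<one> \<ominus> b [^] n) \<otimes> b \<oplus> (\<one> \<ominus> b)"
  proof -
    \<comment> \<open>A polynomial identity in \<open>b\<close> and an arbitrary \<open>p\<close>,
      applied at \<open>p = b [^] n\<close>.\<close>
    have "\<one> \<ominus> p \<otimes> b = (\<one> \<ominus> p) \<otimes> b \<oplus> (\<one> \<ominus> b)" if "p \<in> carrier R" for p
      using assms that by algebra
    then show ?thesis using assms by simp
  qed
  also have "\<dots> = (c \<otimes> b \<oplus> \<one>) \<otimes> (\<one> \<ominus> b)"
    unfolding c(2) using assms c(1) by algebra
  finally show ?case
    using assms c(1) by blast
qed

section \<open>Nilpotent elements and powers\<close>

lemma nilradical_mult:
  assumes "a \<in> nilradical R" "c \<in> carrier R"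
  shows "a \<otimes> c \<in> nilradical R"
proof -
  obtain n :: nat where n: "n \<ge> 1" "a [^] n = \<zero>" and a: "a \<in> carrier R"
    using assms(1) by (auto simp: nilradical_def)
  then have "(a \<otimes> c) [^] n = \<zero>"
    using assms(2) by (simp add: nat_pow_distrib)
  with n(1) a assms(2) show ?thesis
    unfolding nilradical_def by blast
qed

text \<open>Multiplying \<open>a^n c\<close> by \<open>c^(n-1)\<close> produces
  \<open>(a c)^n\<close>. So if the former is nilpotent, then so is \<open>(a c)^n\<close>, and
  hence \<open>a c\<close>.\<close>

lemma nilradical_power:
  assumes "a \<in> carrier R" "c \<in> carrier R" "n \<ge> 1" "a [^] (n::nat) \<otimes> c \<in> nilradical R"
  shows "a \<otimes> c \<in> nilradical R"
proof -
  obtain t :: nat where t: "t \<ge> 1" "(a [^] n \<otimes> c) [^] t = \<zero>"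
    using assms by (auto simp: nilradical_def)
  have "a [^] n \<otimes> c \<otimes> c [^] (n - 1) = (a \<otimes> c) [^] n"
  proof -
    \<comment> \<open>The truncated subtraction is harmless because
      \<open>n \<ge> 1\<close>.\<close>
    have "c \<otimes> c [^] (n - 1) = c [^] n"
      using nat_pow_mult[OF assms(2), of 1 "n - 1"] assms(2,3) by simp
    then show ?thesis
      using assms(1,2) by (simp add: m_assoc nat_pow_distrib)
  qed
  moreover have "(a [^] n \<otimes> c \<otimes> c [^] (n - 1)) [^] t = \<zero>"
    using assms(1,2) t nat_pow_distrib[of "a [^] n \<otimes> c" "c [^] (n - 1)" t] by simp
  ultimately have "(a \<otimes> c) [^] (n * t) = \<zero>"
    using assms(1,2) by (simp add: nat_pow_pow)
  moreover have "n * t \<ge> 1"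
    using assms(3) t(1) by simp
  ultimately show ?thesis
    using assms(1,2) unfolding nilradical_def by blast
qed

lemma fixed_power_if_nilpotent:
  assumes "ideal I R" "b \<in> I" "a \<in> carrier R" "a \<otimes> (\<one> \<ominus> b) \<in> nilradical R"
  shows "\<exists>t\<ge>1. \<exists>c\<in>I. a [^] (t::nat) = a [^] t \<otimes> c"
proof -
  interpret I: ideal I R by fact
  have b: "b \<in> carrier R" using assms(2) by (rule I.Icarr)
  obtain t :: nat where t: "t \<ge> 1" "(a \<otimes> (\<one> \<ominus> b)) [^] t = \<zero>"
    using assms(4) by (auto simp: nilradical_def)
  obtain c where c: "c \<in> I" "(\<one> \<ominus> b) [^] t = \<one> \<ominus> c"
    using one_minus_pow[OF assms(1,2)] by blast
  have "a [^] t \<otimes> (\<one> \<ominus> c) = \<zero>"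
    using t(2) b assms(3) c(2) by (simp add: nat_pow_distrib)
  then have "a [^] t = a [^] t \<otimes> c"
    using fixed_by_iff assms(3) I.Icarr[OF c(1)] by simp
  with t(1) c(1) show ?thesis by blast
qed

text \<open>In this direction the multiplier stays the same: \<open>a^t (1 - b)\<close> is zero,
  hence nilpotent, and \<open>nilradical_power\<close> removes the exponent.\<close>

lemma nilpotent_if_fixed_power:
  assumes "a \<in> carrier R" "b \<in> carrier R" "t \<ge> 1" "a [^] (t::nat) = a [^] t \<otimes> b"
  shows "a \<otimes> (\<one> \<ominus> b) \<in> nilradical R"
proof (rule nilradical_power[OF assms(1) _ assms(3)])
  have "a [^] t \<otimes> (\<one> \<ominus> b) = \<zero>"
    using fixed_by_iff[of "a [^] t" b] assms by simp
  moreover have "\<zero> \<in> nilradical R"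
    unfolding nilradical_def by (auto intro!: exI[of _ "1::nat"])
  ultimately show "a [^] t \<otimes> (\<one> \<ominus> b) \<in> nilradical R"
    by simp
qed (use assms in simp)

section \<open>N-purity through fixed powers and annihilators\<close>

lemma N_pure_ideal_iff_fixed_power:
  assumes "ideal I R"
  shows "N_pure_ideal I R \<longleftrightarrow> (\<forall>a\<in>I. \<exists>t\<ge>1. \<exists>b\<in>I. a [^] (t::nat) = a [^] t \<otimes> b)"
proof -
  interpret I: ideal I R by fact
  have "(\<exists>b\<in>I. a \<otimes> (\<one> \<ominus> b) \<in> nilradical R) \<longleftrightarrow>
      (\<exists>t\<ge>1. \<exists>b\<in>I. a [^] (t::nat) = a [^] t \<otimes> b)" if "a \<in> I" for a
    using fixed_power_if_nilpotent[OF assms] nilpotent_if_fixed_power I.Icarr that by meson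
  then show ?thesis
    using assms unfolding N_pure_ideal_def by blast
qed

text \<open>The product of \<open>1 - b\<close> for the old elements and \<open>1 - c\<close> for
  the new one is again some \<open>1 - d\<close>. Since the nilradical absorbs multiplication, this
  product sends into it everything that either factor does.\<close>

lemma N_pure_ideal_finite_common_unit:
  assumes "N_pure_ideal I R" "finite A" "A \<subseteq> I"
  shows "\<exists>b\<in>I. \<forall>a\<in>A. a \<otimes> (\<one> \<ominus> b) \<in> nilradical R"
  using assms(2,3)
proof (induction A)
  case empty
  interpret I: ideal I R using assms(1) by (simp add: N_pure_ideal_def)
  show ?case using I.zero_closed by blast
next
  case (insert x A)
  have id: "ideal I R" using assms(1) by (simp add: N_pure_ideal_def)
  interpret I: ideal I R by (rule id)
  obtain b where b: "b \<in> I" "\<forall>a\<in>A. a \<otimes> (\<one> \<ominus> b) \<in> nilradical R"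
    using insert by auto
  obtain c where c: "c \<in> I" "x \<otimes> (\<one> \<ominus> c) \<in> nilradical R"
    using insert.prems assms(1) unfolding N_pure_ideal_def by blast
  obtain d where d: "d \<in> I" "(\<one> \<ominus> b) \<otimes> (\<one> \<ominus> c) = \<one> \<ominus> d"
    using one_minus_mult[OF id b(1) c(1)] by blast
  have bc: "\<one> \<ominus> b \<in> carrier R" "\<one> \<ominus> c \<in> carrier R"
    using b(1) c(1) I.Icarr by auto
  have "a \<otimes> (\<one> \<ominus> d) \<in> nilradical R" if "a \<in> insert x A" for a
  proof -
    have a: "a \<in> carrier R"
      using that insert.prems I.Icarr by blast
    have "a \<otimes> (\<one> \<ominus> d) = a \<otimes> (\<one> \<ominus> b) \<otimes> (\<one> \<ominus> c)"
      "a \<otimes> (\<one> \<ominus> d) = a \<otimes> (\<one> \<ominus> c) \<otimes> (\<one> \<ominus> b)"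
      using a bc by (simp_all add: d(2)[symmetric] m_ac)
    then show ?thesis
      using that b(2) c(2) bc nilradical_mult by (metis insertE)
  qed
  with d(1) show ?case by blast
qed

text \<open>After a common multiplier is found, only the nilpotency exponents still depend on the
  element. Any common upper bound \<open>t\<close> serves for all, and expanding
  \<open>(1 - b)^t\<close> then gives one \<open>c\<close> for the whole set.\<close>

lemma N_pure_ideal_finite_fixed_power:
  assumes "N_pure_ideal I R" "finite A" "A \<subseteq> I"
  shows "\<exists>b\<in>I. \<exists>t\<ge>1. \<forall>a\<in>A. a [^] (t::nat) = a [^] t \<otimes> b"
proof -
  have id: "ideal I R" using assms(1) by (simp add: N_pure_ideal_def)
  interpret I: ideal I R by (rule id)
  obtain b where b: "b \<in> I" "\<forall>a\<in>A. a \<otimes> (\<one> \<ominus> b) \<in> nilradical R"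
    using N_pure_ideal_finite_common_unit[OF assms] by blast
  then obtain f :: "'a \<Rightarrow> nat" where f: "(a \<otimes> (\<one> \<ominus> b)) [^] f a = \<zero>" if "a \<in> A" for a
    unfolding nilradical_def by simp metis
  \<comment> \<open>The sum dominates each exponent \<open>f a\<close>; the successor secures
    \<open>t \<ge> 1\<close>, also for empty \<open>A\<close>.\<close>
  define t where "t = Suc (\<Sum>a\<in>A. f a)"
  obtain c where c: "c \<in> I" "(\<one> \<ominus> b) [^] t = \<one> \<ominus> c"
    using one_minus_pow[OF id b(1)] by blast
  have "a [^] t = a [^] t \<otimes> c" if "a \<in> A" for a
  proof -
    have ab: "a \<in> carrier R" "\<one> \<ominus> b \<in> carrier R"
      using that assms(3) b(1) I.Icarr by auto
    have "f a \<le> t"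
      unfolding t_def using member_le_sum[OF that, of f] assms(2) by simp
    then have "(a \<otimes> (\<one> \<ominus> b)) [^] t = (a \<otimes> (\<one> \<ominus> b)) [^] f a \<otimes> (a \<otimes> (\<one> \<ominus> b)) [^] (t - f a)"
      using ab by (simp add: nat_pow_mult)
    also have "\<dots> = \<zero>"
      using f[OF that] ab by simp
    finally have "a [^] t \<otimes> (\<one> \<ominus> c) = \<zero>"
      using ab c(2) by (simp add: nat_pow_distrib)
    then show ?thesis
      using fixed_by_iff ab I.Icarr[OF c(1)] by simp
  qed
  moreover have "t \<ge> 1" by (simp add: t_def)
  ultimately show ?thesis
    using c(1) by blast
qed

text \<open>Writing \<open>1 = r + b\<close> with \<open>r\<close> annihilating \<open>a\<close> and
  multiplying by \<open>a\<close> gives \<open>a = b a\<close>. Conversely \<open>a = a b\<close>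
  places \<open>1 - b\<close> in the annihilator, and every \<open>x\<close> splits as
  \<open>x (1 - b) + x b\<close>.\<close>

lemma annihilator_comaximal_iff:
  assumes "ideal I R" "a \<in> carrier R"
  shows "annihilator R a <+> I = carrier R \<longleftrightarrow> (\<exists>b\<in>I. a = a \<otimes> b)"
proof
  interpret I: ideal I R by fact
  assume "annihilator R a <+> I = carrier R"
  then have "\<one> \<in> annihilator R a <+> I" by simp
  then obtain r b where rb: "r \<in> carrier R" "r \<otimes> a = \<zero>" "b \<in> I" "\<one> = r \<oplus> b"
    by (auto simp: set_add_def' annihilator_def)
  have "b \<in> carrier R" using rb(3) by (rule I.Icarr)
  then have "a = r \<otimes> a \<oplus> b \<otimes> a"
    using rb(1) assms(2) l_distr[of r b a] unfolding rb(4)[symmetric] by simp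
  then have "a = a \<otimes> b"
    using rb(2) \<open>b \<in> carrier R\<close> assms(2) m_comm by simp
  with rb(3) show "\<exists>b\<in>I. a = a \<otimes> b" ..
next
  interpret I: ideal I R by fact
  assume "\<exists>b\<in>I. a = a \<otimes> b"
  then obtain b where b: "b \<in> I" "a = a \<otimes> b" by blast
  have bR: "b \<in> carrier R" using b(1) by (rule I.Icarr)
  have ann: "a \<otimes> (\<one> \<ominus> b) = \<zero>"
    using fixed_by_iff assms(2) bR b(2) by blast
  have "x \<in> annihilator R a <+>\<^bsub>R\<^esub> I" if x: "x \<in> carrier R" for x
  proof -
    have "x \<otimes> (\<one> \<ominus> b) \<otimes> a = x \<otimes> (a \<otimes> (\<one> \<ominus> b))"
      using x bR assms(2) by algebra
    then have "x \<otimes> (\<one> \<ominus> b) \<in> annihilator R a"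
      using x bR ann by (simp add: annihilator_def)
    moreover have "x \<otimes> b \<in> I"
      using b(1) x by (rule I.I_l_closed)
    moreover have "x = x \<otimes> (\<one> \<ominus> b) \<oplus> x \<otimes> b"
      using x bR by algebra
    ultimately show ?thesis
      unfolding set_add_def' by blast
  qed
  then show "annihilator R a <+> I = carrier R"
    using I.Icarr by (auto simp: set_add_def' annihilator_def)
qed

section \<open>The radical of an ideal\<close>

lemma ideal_pow_mem_mono:
  assumes "ideal I R" "x \<in> carrier R" "x [^] n \<in> I" "n \<le> (m::nat)"
  shows "x [^] m \<in> I"
proof -
  interpret I: ideal I R by fact
  have "x [^] m = x [^] n \<otimes> x [^] (m - n)"
    using assms(2,4) by (simp add: nat_pow_mult)
  then show ?thesis
    using assms(2,3) by (simp add: I.I_r_closed)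
qed

text \<open>A binomial expansion without coefficients: splitting off one factor \<open>x + y\<close>
  lowers \<open>k\<close> and raises \<open>i\<close> or \<open>j\<close>, so
  \<open>i + j + k\<close> is preserved. At \<open>k = 0\<close> the bound forces
  \<open>n \<le> i\<close> or \<open>m \<le> j\<close>.\<close>

lemma ideal_add_pow_mem:
  assumes "ideal I R" "x \<in> carrier R" "y \<in> carrier R" "x [^] n \<in> I" "y [^] m \<in> I"
    "n + m \<le> i + j + (k::nat)"
  shows "x [^] i \<otimes> y [^] j \<otimes> (x \<oplus> y) [^] k \<in> I"
  using assms(6)
proof (induction k arbitrary: i j)
  case 0
  interpret I: ideal I R by fact
  have "x [^] i \<in> I \<or> y [^] j \<in> I"
  proof (cases "n \<le> i")
    case True
    then show ?thesis using ideal_pow_mem_mono assms by blast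
  next
    case False
    then have "m \<le> j" using 0 by simp
    then show ?thesis using ideal_pow_mem_mono assms by blast
  qed
  then have "x [^] i \<otimes> y [^] j \<in> I"
    using assms(2,3) by (auto intro: I.I_l_closed I.I_r_closed)
  then show ?case
    using assms(2,3) by simp
next
  case (Suc k)
  interpret I: ideal I R by fact
  have "p \<otimes> q \<otimes> (s \<otimes> (x \<oplus> y)) = p \<otimes> x \<otimes> q \<otimes> s \<oplus> p \<otimes> (q \<otimes> y) \<otimes> s"
    if "p \<in> carrier R" "q \<in> carrier R" "s \<in> carrier R" for p q s
    using that assms(2,3) by algebra
  then have "x [^] i \<otimes> y [^] j \<otimes> (x \<oplus> y) [^] Suc k =
      x [^] Suc i \<otimes> y [^] j \<otimes> (x \<oplus> y) [^] k \<oplus> x [^] i \<otimes> y [^] Suc j \<otimes> (x \<oplus> y) [^] k"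
    using assms(2,3) by simp
  moreover have "x [^] Suc i \<otimes> y [^] j \<otimes> (x \<oplus> y) [^] k \<in> I"
    by (rule Suc.IH) (use Suc.prems in simp)
  moreover have "x [^] i \<otimes> y [^] Suc j \<otimes> (x \<oplus> y) [^] k \<in> I"
    by (rule Suc.IH) (use Suc.prems in simp)
  ultimately show ?case
    using I.a_closed by simp
qed

lemma ideal_subset_ideal_radical:
  assumes "ideal I R"
  shows "I \<subseteq> ideal_radical R I"
proof
  interpret I: ideal I R by fact
  fix x assume "x \<in> I"
  then show "x \<in> ideal_radical R I"
    using I.Icarr unfolding ideal_radical_def by (auto intro!: exI[of _ "1::nat"])
qed

lemma ideal_ideal_radical:
  assumes "ideal I R"
  shows "ideal (ideal_radical R I) R"
proof -
  interpret I: ideal I R by fact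
  have mult: "r \<otimes> x \<in> ideal_radical R I"
    if "x \<in> ideal_radical R I" "r \<in> carrier R" for x r
    using that by (auto simp: ideal_radical_def nat_pow_distrib intro: I.I_l_closed)
  have add: "x \<oplus> y \<in> ideal_radical R I"
    if xy: "x \<in> ideal_radical R I" "y \<in> ideal_radical R I" for x y
  proof -
    obtain n m :: nat where nm: "n \<ge> 1" "m \<ge> 1" "x [^] n \<in> I" "y [^] m \<in> I"
      and "x \<in> carrier R" "y \<in> carrier R"
      using xy by (auto simp: ideal_radical_def)
    \<comment> \<open>Starting with \<open>i = j = 0\<close> leaves only the power of the
      sum.\<close>
    moreover from this have "(x \<oplus> y) [^] (n + m) \<in> I"
      using ideal_add_pow_mem[OF assms, of x y n m 0 0 "n + m"] by simp
    ultimately show ?thesis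
      unfolding ideal_radical_def by (auto intro!: exI[of _ "n + m"])
  qed
  have carr: "ideal_radical R I \<subseteq> carrier R"
    by (auto simp: ideal_radical_def)
  show ?thesis
  proof (rule idealI)
    show "subgroup (ideal_radical R I) (add_monoid R)"
    proof (rule add.subgroupI)
      show "ideal_radical R I \<noteq> {}"
        using ideal_subset_ideal_radical[OF assms] I.zero_closed by blast
      show "\<ominus> x \<in> ideal_radical R I" if "x \<in> ideal_radical R I" for x
        using mult[OF that, of "\<ominus> \<one>"] that carr by (auto simp: l_minus)
    qed (use carr add in auto)
    show "x \<otimes> r \<in> ideal_radical R I" if "x \<in> ideal_radical R I" "r \<in> carrier R" for x r
      using mult[OF that] that carr m_comm by fastforce
  qed (use mult ring_axioms in auto)
qed

text \<open>Descending to \<open>I\<close>, a multiplier \<open>b\<close> in the radical is replaced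
  by a power \<open>b^m\<close> in \<open>I\<close>; this is allowed since \<open>1 - b\<close>
  divides \<open>1 - b^m\<close>. Ascending, N-purity is applied to a power \<open>a^n\<close> in
  \<open>I\<close>, and \<open>nilradical_power\<close> brings the result back to
  \<open>a\<close>.\<close>

lemma N_pure_ideal_ideal_radical_iff:
  assumes "ideal I R"
  shows "N_pure_ideal (ideal_radical R I) R \<longleftrightarrow> N_pure_ideal I R"
proof
  interpret I: ideal I R by fact
  assume pure: "N_pure_ideal (ideal_radical R I) R"
  have "\<exists>b\<in>I. a \<otimes> (\<one> \<ominus> b) \<in> nilradical R" if a: "a \<in> I" for a
  proof -
    obtain b where b: "b \<in> ideal_radical R I" "a \<otimes> (\<one> \<ominus> b) \<in> nilradical R"
      using a pure ideal_subset_ideal_radical[OF assms] unfolding N_pure_ideal_def by blast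
    then obtain m :: nat where m: "b [^] m \<in> I" and bR: "b \<in> carrier R"
      by (auto simp: ideal_radical_def)
    obtain c where c: "c \<in> carrier R" "\<one> \<ominus> b [^] m = c \<otimes> (\<one> \<ominus> b)"
      using one_minus_dvd_one_minus_pow[OF bR] by blast
    have "a \<otimes> (\<one> \<ominus> b [^] m) = a \<otimes> (\<one> \<ominus> b) \<otimes> c"
      using I.Icarr[OF a] bR c by (simp add: m_ac)
    then have "a \<otimes> (\<one> \<ominus> b [^] m) \<in> nilradical R"
      using nilradical_mult[OF b(2) c(1)] by simp
    with m show ?thesis by blast
  qed
  then show "N_pure_ideal I R"
    using assms by (simp add: N_pure_ideal_def)
next
  interpret I: ideal I R by fact
  assume pure: "N_pure_ideal I R"
  have "\<exists>b\<in>ideal_radical R I. a \<otimes> (\<one> \<ominus> b) \<in> nilradical R"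
    if "a \<in> ideal_radical R I" for a
  proof -
    obtain n :: nat where n: "n \<ge> 1" "a [^] n \<in> I" and aR: "a \<in> carrier R"
      using \<open>a \<in> ideal_radical R I\<close> by (auto simp: ideal_radical_def)
    then obtain b where b: "b \<in> I" "a [^] n \<otimes> (\<one> \<ominus> b) \<in> nilradical R"
      using pure unfolding N_pure_ideal_def by blast
    then have "a \<otimes> (\<one> \<ominus> b) \<in> nilradical R"
      using nilradical_power[OF aR _ n(1)] I.Icarr by simp
    with b(1) show ?thesis
      using ideal_subset_ideal_radical[OF assms] by blast
  qed
  then show "N_pure_ideal (ideal_radical R I) R"
    using ideal_ideal_radical[OF assms] by (simp add: N_pure_ideal_def)
qed

section \<open>Pure ideals with a given radical\<close>

lemma pure_ideal_imp_N_pure_ideal: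
  assumes "pure_ideal J R"
  shows "N_pure_ideal J R"
proof -
  have "\<zero> \<in> nilradical R"
    unfolding nilradical_def by (auto intro!: exI[of _ "1::nat"])
  then show ?thesis
    using assms unfolding pure_ideal_def N_pure_ideal_def by metis
qed

text \<open>Purity makes \<open>a\<close> equal to \<open>a b^m\<close> for every \<open>m\<close>,
  and some \<open>b^m\<close> already lies in \<open>K\<close>. Applied in both directions, this
  yields uniqueness.\<close>

lemma pure_ideal_subset:
  assumes "pure_ideal J R" "ideal K R" "J \<subseteq> ideal_radical R K"
  shows "J \<subseteq> K"
proof
  fix a assume a: "a \<in> J"
  interpret J: ideal J R using assms(1) by (simp add: pure_ideal_def)
  interpret K: ideal K R by fact
  obtain b where b: "b \<in> J" "a \<otimes> (\<one> \<ominus> b) = \<zero>"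
    using assms(1) a unfolding pure_ideal_def by blast
  then obtain m :: nat where m: "b [^] m \<in> K"
    using assms(3) by (auto simp: ideal_radical_def)
  have "a = a \<otimes> b"
    using fixed_by_iff[OF J.Icarr[OF a] J.Icarr[OF b(1)]] b(2) by (rule iffD1)
  then have "a = a \<otimes> b [^] m"
    by (rule fixed_by_pow[OF J.Icarr[OF a] J.Icarr[OF b(1)]])
  then show "a \<in> K"
    using K.I_l_closed[OF m J.Icarr[OF a]] by (rule ssubst)
qed

lemma pure_ideal_unique:
  assumes "pure_ideal J R" "pure_ideal K R" "ideal_radical R J = ideal_radical R K"
  shows "J = K"
proof -
  have ids: "ideal J R" "ideal K R"
    using assms(1,2) by (simp_all add: pure_ideal_def)
  show ?thesis
  proof
    show "J \<subseteq> K"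
      using pure_ideal_subset[OF assms(1) ids(2)] ideal_subset_ideal_radical[OF ids(1)] assms(3) by simp
    show "K \<subseteq> J"
      using pure_ideal_subset[OF assms(2) ids(1)] ideal_subset_ideal_radical[OF ids(2)] assms(3) by simp
  qed
qed

text \<open>Closure under sums is the substantial point: if \<open>1 - b\<close> kills
  \<open>x\<close> and \<open>1 - c\<close> kills \<open>y\<close>, their product kills
  \<open>x + y\<close> and is again of the form \<open>1 - d\<close>.\<close>

lemma ideal_fixed_elements:
  assumes "ideal I R"
  shows "ideal {a \<in> carrier R. \<exists>b\<in>I. a \<otimes> (\<one> \<ominus> b) = \<zero>} R" (is "ideal ?J R")
proof -
  interpret I: ideal I R by fact
  have mult: "r \<otimes> x \<in> ?J" if x_J: "x \<in> ?J" and r: "r \<in> carrier R" for x r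
  proof -
    obtain b where b: "b \<in> I" "x \<otimes> (\<one> \<ominus> b) = \<zero>" and x: "x \<in> carrier R"
      using x_J by blast
    have "r \<otimes> x \<otimes> (\<one> \<ominus> b) = \<zero>"
      using x r I.Icarr[OF b(1)] b(2) by (simp add: m_assoc)
    then show ?thesis
      using b(1) x r by blast
  qed
  have add: "x \<oplus> y \<in> ?J" if xy: "x \<in> ?J" "y \<in> ?J" for x y
  proof -
    obtain b c where b: "b \<in> I" "x \<otimes> (\<one> \<ominus> b) = \<zero>" and c: "c \<in> I" "y \<otimes> (\<one> \<ominus> c) = \<zero>"
      and R: "x \<in> carrier R" "y \<in> carrier R"
      using xy by blast
    note bc = I.Icarr[OF b(1)] I.Icarr[OF c(1)]
    obtain d where d: "d \<in> I" "(\<one> \<ominus> b) \<otimes> (\<one> \<ominus> c) = \<one> \<ominus> d"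
      using one_minus_mult[OF assms b(1) c(1)] by blast
    have "(x \<oplus> y) \<otimes> (\<one> \<ominus> d) =
        x \<otimes> (\<one> \<ominus> b) \<otimes> (\<one> \<ominus> c) \<oplus> y \<otimes> (\<one> \<ominus> c) \<otimes> (\<one> \<ominus> b)"
      unfolding d(2)[symmetric] using R bc by algebra
    also have "\<dots> = \<zero>"
      using b(2) c(2) bc by simp
    finally show ?thesis
      using R d(1) by blast
  qed
  show ?thesis
  proof (rule idealI)
    show "subgroup ?J (add_monoid R)"
    proof (rule add.subgroupI)
      have "\<zero> \<otimes> (\<one> \<ominus> \<zero>) = \<zero>"
        by simp
      then have "\<zero> \<in> ?J"
        using I.zero_closed by blast
      then show "?J \<noteq> {}" by blast
      show "\<ominus> x \<in> ?J" if "x \<in> ?J" for x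
      proof -
        have "\<ominus> x = \<ominus> \<one> \<otimes> x"
          using that by (simp add: l_minus)
        then show ?thesis
          using mult[OF that, of "\<ominus> \<one>"] by simp
      qed
    qed (use add in auto)
    show "x \<otimes> r \<in> ?J" if "x \<in> ?J" "r \<in> carrier R" for x r
    proof -
      have "x \<otimes> r = r \<otimes> x"
        using that m_comm by blast
      then show ?thesis
        using mult[OF that] by simp
    qed
  qed (use mult ring_axioms in auto)
qed

lemma N_pure_ideal_obtain_pure_ideal:
  assumes "N_pure_ideal I R"
  obtains J where "pure_ideal J R" "ideal_radical R I = ideal_radical R J"
proof
  have id: "ideal I R" using assms by (simp add: N_pure_ideal_def)
  interpret I: ideal I R by (rule id)
  let ?J = "{a \<in> carrier R. \<exists>b\<in>I. a \<otimes> (\<one> \<ominus> b) = \<zero>}"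
  \<comment> \<open>N-purity enters here. The same fact gives both the purity of \<open>?J\<close>
    and the harder inclusion of radicals.\<close>
  have pow: "\<exists>t\<ge>1. a [^] (t::nat) \<in> ?J" if a: "a \<in> I" for a
  proof -
    obtain t :: nat and b where t: "t \<ge> 1" and b: "b \<in> I" "a [^] t = a [^] t \<otimes> b"
      using a assms N_pure_ideal_iff_fixed_power[OF id] by meson
    have "a [^] t \<otimes> (\<one> \<ominus> b) = \<zero>"
      using fixed_by_iff[OF nat_pow_closed[OF I.Icarr[OF a]] I.Icarr[OF b(1)]] b(2) by (rule iffD2)
    with t b(1) I.Icarr[OF a] show ?thesis by blast
  qed
  have "\<exists>c\<in>?J. a \<otimes> (\<one> \<ominus> c) = \<zero>" if a_J: "a \<in> ?J" for a
  proof -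
    obtain b where b: "b \<in> I" "a \<otimes> (\<one> \<ominus> b) = \<zero>" and a: "a \<in> carrier R"
      using a_J by blast
    note bR = I.Icarr[OF b(1)]
    \<comment> \<open>The multiplier \<open>b\<close> is only known to lie in \<open>I\<close>; a
      power of it lies in \<open>?J\<close> and still fixes \<open>a\<close>.\<close>
    obtain t :: nat where t: "b [^] t \<in> ?J"
      using pow[OF b(1)] by blast
    have "a = a \<otimes> b"
      using fixed_by_iff[OF a bR] b(2) by (rule iffD1)
    then have "a = a \<otimes> b [^] t"
      by (rule fixed_by_pow[OF a bR])
    then have "a \<otimes> (\<one> \<ominus> b [^] t) = \<zero>"
      by (rule fixed_by_iff[OF a nat_pow_closed[OF bR], THEN iffD2])
    with t show ?thesis by blast
  qed
  then show "pure_ideal ?J R"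
    using ideal_fixed_elements[OF id] unfolding pure_ideal_def by blast
  show "ideal_radical R I = ideal_radical R ?J"
  proof
    have "?J \<subseteq> I"
    proof
      fix a assume "a \<in> ?J"
      then obtain b where b: "b \<in> I" "a \<otimes> (\<one> \<ominus> b) = \<zero>" and a: "a \<in> carrier R"
        by blast
      have "a = a \<otimes> b"
        using fixed_by_iff[OF a I.Icarr[OF b(1)]] b(2) by (rule iffD1)
      then show "a \<in> I"
        using I.I_l_closed[OF b(1) a] by (rule ssubst)
    qed
    then show "ideal_radical R ?J \<subseteq> ideal_radical R I"
      unfolding ideal_radical_def by blast
    show "ideal_radical R I \<subseteq> ideal_radical R ?J"
    proof
      fix a assume "a \<in> ideal_radical R I"
      then obtain n :: nat where a: "a \<in> carrier R" "n \<ge> 1" "a [^] n \<in> I"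
        by (auto simp: ideal_radical_def)
      obtain t :: nat where t: "t \<ge> 1" "(a [^] n) [^] t \<in> ?J"
        using pow[OF a(3)] by blast
      have "a [^] (n * t) \<in> ?J"
        using t(2) by (simp only: nat_pow_pow[OF a(1)])
      moreover have "n * t \<ge> 1"
        using a(2) t(1) by simp
      ultimately show "a \<in> ideal_radical R ?J"
        using a(1) unfolding ideal_radical_def by blast
    qed
  qed
qed

section \<open>The equivalent conditions\<close>

lemma N_pure_ideal_iff_annihilator:
  assumes "ideal I R"
  shows "N_pure_ideal I R \<longleftrightarrow>
    (\<forall>a\<in>I. \<exists>t::nat. t \<ge> 1 \<and> annihilator R (a [^] t) <+> I = carrier R)"
proof -
  have "annihilator R (a [^] t) <+> I = carrier R \<longleftrightarrow> (\<exists>b\<in>I. a [^] t = a [^] t \<otimes> b)"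
    if "a \<in> I" for a and t :: nat
    using annihilator_comaximal_iff[OF assms] ideal.Icarr[OF assms that] by blast
  then show ?thesis
    unfolding N_pure_ideal_iff_fixed_power[OF assms] by blast
qed

text \<open>Comaximality gives \<open>a^n = a^n b\<close>, which lies in \<open>I\<close>; the other
  inclusion applies N-purity to a power of \<open>a\<close> in \<open>I\<close>. For the converse,
  \<open>I\<close> lies in its radical, so the equality yields the annihilator condition on
  \<open>I\<close>.\<close>

lemma N_pure_ideal_iff_ideal_radical_eq:
  assumes "ideal I R"
  shows "N_pure_ideal I R \<longleftrightarrow> ideal_radical R I =
    {a \<in> carrier R. \<exists>n::nat. n \<ge> 1 \<and> annihilator R (a [^] n) <+> I = carrier R}"
    (is "_ \<longleftrightarrow> _ = ?C")
proof
  interpret I: ideal I R by fact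
  assume pure: "N_pure_ideal I R"
  have "a \<in> ideal_radical R I" if a_C: "a \<in> ?C" for a
  proof -
    obtain n :: nat and b where nb: "n \<ge> 1" "b \<in> I" "a [^] n = a [^] n \<otimes> b" "a \<in> carrier R"
      using a_C annihilator_comaximal_iff[OF assms] nat_pow_closed by blast
    then have "a [^] n \<in> I"
      using I.I_l_closed[of b "a [^] n"] nat_pow_closed by metis
    then show ?thesis
      using nb unfolding ideal_radical_def by blast
  qed
  moreover have "a \<in> ?C" if a_rad: "a \<in> ideal_radical R I" for a
  proof -
    obtain n :: nat where a: "a \<in> carrier R" "n \<ge> 1" "a [^] n \<in> I"
      using a_rad by (auto simp: ideal_radical_def)
    then obtain t :: nat where t: "t \<ge> 1" "annihilator R ((a [^] n) [^] t) <+> I = carrier R"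
      using pure N_pure_ideal_iff_annihilator[OF assms] by blast
    have "annihilator R (a [^] (n * t)) <+> I = carrier R"
      using t(2) a(1) nat_pow_pow by simp
    moreover have "n * t \<ge> 1"
      using a(2) t(1) by simp
    ultimately show ?thesis
      using a(1) by blast
  qed
  ultimately show "ideal_radical R I = ?C" by blast
next
  assume "ideal_radical R I = ?C"
  then show "N_pure_ideal I R"
    using ideal_subset_ideal_radical[OF assms] N_pure_ideal_iff_annihilator[OF assms] by blast
qed

text \<open>For the converse, N-purity travels from the pure ideal \<open>J\<close> up to the common
  radical and from there down to \<open>I\<close>.\<close>

lemma N_pure_ideal_iff_unique_pure_ideal:
  assumes "ideal I R"
  shows "N_pure_ideal I R \<longleftrightarrow> (\<exists>!J. pure_ideal J R \<and> ideal_radical R I = ideal_radical R J)"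
proof
  assume "N_pure_ideal I R"
  then obtain J where "pure_ideal J R" "ideal_radical R I = ideal_radical R J"
    by (rule N_pure_ideal_obtain_pure_ideal)
  then show "\<exists>!J. pure_ideal J R \<and> ideal_radical R I = ideal_radical R J"
    using pure_ideal_unique by metis
next
  assume "\<exists>!J. pure_ideal J R \<and> ideal_radical R I = ideal_radical R J"
  then obtain J where J: "pure_ideal J R" "ideal_radical R I = ideal_radical R J"
    by blast
  then have "N_pure_ideal (ideal_radical R J) R"
    using N_pure_ideal_ideal_radical_iff pure_ideal_imp_N_pure_ideal
    unfolding pure_ideal_def by blast
  then show "N_pure_ideal I R"
    using N_pure_ideal_ideal_radical_iff[OF assms] J(2) by simp
qed

lemma N_pure_ideal_iff_finite_fixed_power:
  assumes "ideal I R"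
  shows "N_pure_ideal I R \<longleftrightarrow>
    (\<forall>(n::nat) (a::nat \<Rightarrow> 'a). (\<forall>k\<in>{1..n}. a k \<in> I) \<longrightarrow>
      (\<exists>b\<in>I. \<exists>t::nat. t \<ge> 1 \<and> (\<forall>k\<in>{1..n}. a k [^] t = a k [^] t \<otimes> b)))"
    (is "_ \<longleftrightarrow> ?F")
proof
  assume pure: "N_pure_ideal I R"
  show ?F
  proof (intro allI impI)
    fix n :: nat and a :: "nat \<Rightarrow> 'a"
    assume "\<forall>k\<in>{1..n}. a k \<in> I"
    then show "\<exists>b\<in>I. \<exists>t::nat. t \<ge> 1 \<and> (\<forall>k\<in>{1..n}. a k [^] t = a k [^] t \<otimes> b)"
      using N_pure_ideal_finite_fixed_power[OF pure, of "a ` {1..n}"] by auto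
  qed
next
  assume F: ?F
  have "\<exists>t\<ge>1. \<exists>b\<in>I. a [^] (t::nat) = a [^] t \<otimes> b" if "a \<in> I" for a
    \<comment> \<open>A family of length one suffices to recover the condition for a single
      element.\<close>
    using F[rule_format, of 1 "\<lambda>_. a"] that by auto
  then show "N_pure_ideal I R"
    using N_pure_ideal_iff_fixed_power[OF assms] by blast
qed

end

theorem theorem2p6:
  fixes R :: "('a, 'm) ring_scheme" (structure) and I :: "'a set"
  assumes "cring R" and "ideal I R"
  shows
    "(N_pure_ideal I R \<longleftrightarrow>
        (\<forall>(n::nat) (a::nat \<Rightarrow> 'a). (\<forall>k\<in>{1..n}. a k \<in> I) \<longrightarrow>
          (\<exists>b\<in>I. \<exists>t::nat. t \<ge> 1 \<and> (\<forall>k\<in>{1..n}. a k [^] t = a k [^] t \<otimes> b)))) \<and>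
     (N_pure_ideal I R \<longleftrightarrow>
        (\<forall>a\<in>I. \<exists>t::nat. t \<ge> 1 \<and> annihilator R (a [^] t) <+> I = carrier R)) \<and>
     (N_pure_ideal I R \<longleftrightarrow>
        ideal_radical R I =
          {a \<in> carrier R. \<exists>n::nat. n \<ge> 1 \<and> annihilator R (a [^] n) <+> I = carrier R}) \<and>
     (N_pure_ideal I R \<longleftrightarrow> N_pure_ideal (ideal_radical R I) R) \<and>
     (N_pure_ideal I R \<longleftrightarrow>
        (\<exists>!J. pure_ideal J R \<and> ideal_radical R I = ideal_radical R J))"
proof -
  interpret cring R by fact
  show ?thesis
    using N_pure_ideal_iff_finite_fixed_power[OF assms(2)]
      N_pure_ideal_iff_annihilator[OF assms(2)]
      N_pure_ideal_iff_ideal_radical_eq[OF assms(2)]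
      N_pure_ideal_ideal_radical_iff[OF assms(2)]
      N_pure_ideal_iff_unique_pure_ideal[OF assms(2)]
    by (intro conjI) (rule refl | assumption | blast)+
qed

end
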